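(* Let $\mathcal{B}$ be a boolean $\mathcal{C}$-algebra. Then $\mathcal{B}$ is $\mathrm{u}_\omega$-compact if and only if for every $k\in\mathbb{N}$ there is no $E_k$-system over $\mathcal{B}$.
   Context: Language. Let $\mathcal{L}=\{\vee,\cdot,\bar{\ },0,1\}\cup\{\mathbf{c}_i\mid i\in I\}$ be the language of boolean algebras (disjunction, conjunction, negation, $0$, $1$) extended by an arbitrary (possibly infinite) set of constant symbols. A boolean $\mathcal{C}$-algebra is a boolean algebra $\mathcal{B}$ regarded as a structure of the language $\mathcal{L}$, where $\mathcal{C}\subseteq\mathcal{B}$ denotes the boolean subalgebra generated by (the interpretations of) the constants $\mathbf{c}_i$, $i\in I$. Equations. For a finite set of variables $X=\{x_1,\dots,x_n\}$, an equation over $\mathcal{B}$ is an atomic formula $\tau(X)=\sigma(X)$, where $\tau,\sigma$ are $\mathcal{L}$-terms in $X$. A system is an arbitrary (possibly infinite) set of equations in a common finite set of variables. $V_{\mathcal{B}}(\mathcal{S})\subseteq\mathcal{B}^n$ denotes the solution set of $\mathcal{S}$ in $\mathcal{B}$ (and $V_{\mathcal{B}}(\tau(X)=\sigma(X))$ that of a single equation). $\mathrm{u}_\omega$-compactness. $\mathcal{B}$ is $\mathrm{u}_\omega$-compact if for any system $\mathcal{S}$ and any finite set of equations $\tau_i(X)=\sigma_i(X)$ ($1\le i\le m$) with $V_{\mathcal{B}}(\mathcal{S})\subseteq\bigcup_{i=1}^m V_{\mathcal{B}}(\tau_i(X)=\sigma_i(X))$ there exists a finite subsystem $\mathcal{S}'\subseteq\mathcal{S}$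 with $V_{\mathcal{B}}(\mathcal{S}')\subseteq\bigcup_{i=1}^m V_{\mathcal{B}}(\tau_i(X)=\sigma_i(X))$. $E_k$-systems. For $k\in\mathbb{N}=\{0,1,2,\dots\}$ (with $0$ included), a system $\mathcal{S}$ over $\mathcal{B}$ is an $E_k$-system if $|V_{\mathcal{B}}(\mathcal{S})|=k$ but $V_{\mathcal{B}}(\mathcal{S}')$ is infinite for every finite subsystem $\mathcal{S}'\subseteq\mathcal{S}$. *)

theory Defs
  imports Main "HOL-Library.FuncSet"
begin

text \<open>
  A boolean \<open>C\<close>-algebra is a boolean algebra, here a type \<open>'a\<close> of class \<^class>\<open>boolean_algebra\<close>
  (the degenerate algebra with \<open>0 = 1\<close> is included), together with an index set \<open>I\<close> of constant
  symbols, possibly empty or infinite, and their interpretation \<open>c\<close>. Only the values of \<open>c\<close> on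
  \<open>I\<close> matter; the subalgebra \<open>C\<close> consists of the values of the variable-free terms over \<open>I\<close>.
\<close>

datatype (csyms: 'i, vars: 'v) bterm =
    Var 'v
  | Const 'i
  | Zero
  | One
  | Or "('i, 'v) bterm" "('i, 'v) bterm"
  | And "('i, 'v) bterm" "('i, 'v) bterm"
  | Neg "('i, 'v) bterm"

primrec eval :: "('i \<Rightarrow> 'a::boolean_algebra) \<Rightarrow> ('v \<Rightarrow> 'a) \<Rightarrow> ('i, 'v) bterm \<Rightarrow> 'a" where
  "eval c v (Var x) = v x"
| "eval c v (Const i) = c i"
| "eval c v Zero = bot"
| "eval c v One = top"
| "eval c v (Or s t) = sup (eval c v s) (eval c v t)"
| "eval c v (And s t) = inf (eval c v s) (eval c v t)"
| "eval c v (Neg s) = - eval c v s"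

text \<open>The variables \<open>x\<^sub>1, \<dots>, x\<^sub>n\<close> are numbered \<open>0, \<dots>, n - 1\<close>.\<close>

definition terms :: "'i set \<Rightarrow> nat \<Rightarrow> ('i, nat) bterm set" where
  "terms I n = {t. csyms t \<subseteq> I \<and> vars t \<subseteq> {..<n}}"

type_synonym 'i equation = "('i, nat) bterm \<times> ('i, nat) bterm"

definition equations :: "'i set \<Rightarrow> nat \<Rightarrow> 'i equation set" where
  "equations I n = terms I n \<times> terms I n"

text \<open>
  Points of \<open>B\<^sup>n\<close> are functions that are \<^const>\<open>undefined\<close> outside \<open>{..<n}\<close>, so that distinct
  functions are distinct points and cardinalities of solution sets are the intended ones.
  The solution set of a system depends on its set of variables, hence on \<open>n\<close>, and not only on
  the variables that occur in it.
\<close>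

definition solutions ::
    "('i \<Rightarrow> 'a::boolean_algebra) \<Rightarrow> nat \<Rightarrow> 'i equation set \<Rightarrow> (nat \<Rightarrow> 'a) set" where
  "solutions c n S = {v \<in> {..<n} \<rightarrow>\<^sub>E UNIV. \<forall>(s, t)\<in>S. eval c v s = eval c v t}"

definition u_omega_compact :: "'i set \<Rightarrow> ('i \<Rightarrow> 'a::boolean_algebra) \<Rightarrow> bool" where
  "u_omega_compact I c \<longleftrightarrow>
    (\<forall>n S T. S \<subseteq> equations I n \<longrightarrow> T \<subseteq> equations I n \<longrightarrow> finite T \<longrightarrow>
      solutions c n S \<subseteq> (\<Union>e\<in>T. solutions c n {e}) \<longrightarrow>
      (\<exists>S'\<subseteq>S. finite S' \<and> solutions c n S' \<subseteq> (\<Union>e\<in>T. solutions c n {e})))"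

text \<open>Finiteness of the solution set is explicit because \<^const>\<open>card\<close> is \<open>0\<close> on infinite sets.\<close>

definition E_system ::
    "'i set \<Rightarrow> ('i \<Rightarrow> 'a::boolean_algebra) \<Rightarrow> nat \<Rightarrow> nat \<Rightarrow> 'i equation set \<Rightarrow> bool" where
  "E_system I c k n S \<longleftrightarrow>
    S \<subseteq> equations I n \<and>
    finite (solutions c n S) \<and> card (solutions c n S) = k \<and>
    (\<forall>S'\<subseteq>S. finite S' \<longrightarrow> infinite (solutions c n S'))"

end

theory Submission imports Defs
begin

text \<open>
  If \<open>S\<close> has exactly \<open>k\<close> solutions, then among any \<open>k + 1\<close> solutions two coincide. With
  \<open>k + 1\<close> disjoint copies of the variables, this is a covering of a solution set by finitely many
  equations, and compactness yields a finite subsystem with at most \<open>k\<close> solutions.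

  Conversely, let \<open>V(S)\<close> be nonempty and covered by the equations \<open>\<tau> = 0\<close> with \<open>\<tau> \<in> T\<close>, where \<open>T\<close>
  is minimal, and let \<open>\<sigma>\<close> be the join of \<open>T\<close>. Solutions can be glued: if \<open>x\<close> solves \<open>S\<close>
  below \<open>y\<close> and \<open>p\<close> solves \<open>S\<close>, then \<open>x\<close> below \<open>y\<close> and \<open>p\<close> below \<open>- y\<close> form a solution. By
  minimality there are \<open>p\<^sub>\<tau> \<in> V(S)\<close> at which no member of \<open>T\<close> other than \<open>\<tau>\<close> vanishes. Gluing onto
  them shows that every nonzero element below some \<open>\<sigma>(q)\<close>, \<open>q \<in> V(S)\<close>, dominates one of the
  finitely many values \<open>\<tau>'(p\<^sub>\<tau>)\<close>, \<open>\<tau>' \<noteq> \<tau>\<close>, so there are only finitely many such elements.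
  Hence the system in \<open>(x, y)\<close> expressing that \<open>S(x)\<close> holds below \<open>y\<close> and
  \<open>x \<le> y \<le> \<sigma>(x)\<close> has finitely many solutions. A finite subsystem has the same solutions, and the
  part of \<open>S\<close> used in it is already covered by \<open>T\<close>.
\<close>

section \<open>Boolean algebra\<close>

lemma inf_compl_eq_bot_iff: "inf a (- b) = bot \<longleftrightarrow> a \<le> b" for a b :: "'a::boolean_algebra"
  by (metis diff_eq diff_shunt_var)

lemma eq_if_inf_eq:
  fixes a b y :: "'a::boolean_algebra"
  assumes "inf y a = inf y b" "inf (- y) a = inf (- y) b"
  shows "a = b"
proof -
  have "x = sup (inf y x) (inf (- y) x)" for x
    by (simp flip: inf_sup_distrib2)
  then show ?thesis
    using assms by metis
qed

lemma inf_symdiff_eq_bot_iff: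
  fixes a b y :: "'a::boolean_algebra"
  shows "inf y (sup (inf a (- b)) (inf (- a) b)) = bot \<longleftrightarrow> inf y a = inf y b"
proof -
  have "inf y (sup (inf a (- b)) (inf (- a) b)) = bot
      \<longleftrightarrow> inf (inf y a) (- b) = bot \<and> inf (inf y b) (- a) = bot"
    by (simp add: inf_sup_distrib1 inf_assoc inf_commute[of "- a" b])
  also have "\<dots> \<longleftrightarrow> inf y a \<le> b \<and> inf y b \<le> a"
    by (simp add: inf_compl_eq_bot_iff)
  also have "\<dots> \<longleftrightarrow> inf y a = inf y b"
  proof
    assume "inf y a \<le> b \<and> inf y b \<le> a"
    then show "inf y a = inf y b"
      by (intro order.antisym) auto
  next
    assume *: "inf y a = inf y b"
    show "inf y a \<le> b \<and> inf y b \<le> a"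
      using inf.cobounded2[of y a] inf.cobounded2[of y b] unfolding * by simp
  qed
  finally show ?thesis .
qed

text \<open>An element \<open>u\<close> of \<open>J\<close> is determined by the members of
  \<open>F\<close> below it: if \<open>u\<close> is not below \<open>u'\<close>, the nonzero
  difference \<open>inf u (- u')\<close> lies in \<open>J\<close> and so dominates some
  \<open>a\<close> in \<open>F\<close>, which is below \<open>u\<close> but not below
  \<open>u'\<close>. Thus \<open>J\<close> injects into \<open>Pow F\<close>.\<close>

lemma finite_down_set_if_dominating:
  fixes J F :: "'a::boolean_algebra set"
  assumes down: "\<And>u v. u \<in> J \<Longrightarrow> v \<le> u \<Longrightarrow> v \<in> J"
    and "finite F" "bot \<notin> F"
    and dom: "\<And>u. u \<in> J \<Longrightarrow> u \<noteq> bot \<Longrightarrow> \<exists>a\<in>F. a \<le> u"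
  shows "finite J"
proof -
  have le: "u \<le> u'" if "u \<in> J" "{a \<in> F. a \<le> u} = {a \<in> F. a \<le> u'}" for u u'
  proof (rule ccontr)
    assume "\<not> u \<le> u'"
    then have "inf u (- u') \<noteq> bot"
      by (simp add: inf_compl_eq_bot_iff)
    moreover have "inf u (- u') \<in> J"
      using down that(1) inf.cobounded1 by blast
    ultimately obtain a where a: "a \<in> F" "a \<le> u" "a \<le> - u'"
      using dom by fastforce
    with that(2) have "a \<le> u'" by blast
    with a(3) have "a \<le> bot"
      by (metis inf.boundedI inf_compl_bot)
    with a(1) \<open>bot \<notin> F\<close> show False
      by (simp add: bot_unique)
  qed
  have "inj_on (\<lambda>u. {a \<in> F. a \<le> u}) J"
    by (rule inj_onI) (metis le order.antisym)
  moreover have "finite ((\<lambda>u. {a \<in> F. a \<le> u}) ` J)"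
    by (rule finite_subset[of _ "Pow F"]) (use \<open>finite F\<close> in auto)
  ultimately show ?thesis
    using finite_imageD by blast
qed

section \<open>Terms and solution sets\<close>

lemma in_equations_iff: "e \<in> equations I n \<longleftrightarrow> fst e \<in> terms I n \<and> snd e \<in> terms I n"
  by (simp add: equations_def mem_Times_iff)

text \<open>Meeting with \<open>y\<close> is a homomorphism onto the boolean algebra of elements
  below \<open>y\<close>, so below \<open>y\<close> a term only sees the parts of its variables
  below \<open>y\<close>.\<close>

lemma eval_local:
  assumes "\<And>l. l \<in> vars t \<Longrightarrow> inf y (u l) = inf y (w l)"
  shows "inf y (eval c u t) = inf y (eval c w t)"
  using assms
proof (induction t)
  case (Or s t)
  then show ?case by (simp add: inf_sup_distrib1)
next
  case (And s t)
  then have "inf (inf y (eval c u s)) (inf y (eval c u t))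
      = inf (inf y (eval c w s)) (inf y (eval c w t))"
    by simp
  then show ?case
    by (simp add: inf_left_commute inf_assoc)
next
  case (Neg s)
  then have "inf y (- inf y (eval c u s)) = inf y (- inf y (eval c w s))"
    by simp
  then show ?case
    by (simp add: inf_sup_distrib1)
qed auto

lemma eval_cong:
  assumes "\<And>l. l \<in> vars t \<Longrightarrow> u l = w l"
  shows "eval c u t = eval c w t"
  using eval_local[of t top u w c] assms by simp

lemma eval_map_bterm: "eval c v (map_bterm id g t) = eval c (v \<circ> g) t"
  by (induction t) auto

text \<open>The equation becomes a term that has to vanish, which also makes sense below a given
  element.\<close>

definition symdiff :: "('i, 'v) bterm \<times> ('i, 'v) bterm \<Rightarrow> ('i, 'v) bterm" where
  "symdiff e = Or (And (fst e) (Neg (snd e))) (And (Neg (fst e)) (snd e))"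

lemma symdiff_in_terms: "symdiff e \<in> terms I n \<longleftrightarrow> e \<in> equations I n"
  by (auto simp: symdiff_def in_equations_iff terms_def)

lemma inf_eval_symdiff:
  "inf y (eval c v (symdiff e)) = bot \<longleftrightarrow> inf y (eval c v (fst e)) = inf y (eval c v (snd e))"
  by (simp add: symdiff_def inf_symdiff_eq_bot_iff)

lemma eval_symdiff: "eval c v (symdiff e) = bot \<longleftrightarrow> eval c v (fst e) = eval c v (snd e)"
  using inf_eval_symdiff[of top c v e] by simp

definition Ors :: "('i, 'v) bterm list \<Rightarrow> ('i, 'v) bterm" where
  "Ors ts = foldr Or ts Zero"

lemma eval_Ors_le: "eval c v (Ors ts) \<le> u \<longleftrightarrow> (\<forall>t\<in>set ts. eval c v t \<le> u)"
  by (induction ts) (auto simp: Ors_def)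

lemma Ors_in_terms: "Ors ts \<in> terms I n \<longleftrightarrow> set ts \<subseteq> terms I n"
  by (induction ts) (auto simp: Ors_def terms_def)

lemma solutions_iff:
  "v \<in> solutions c n S \<longleftrightarrow>
    v \<in> {..<n} \<rightarrow>\<^sub>E UNIV \<and> (\<forall>e\<in>S. eval c v (fst e) = eval c v (snd e))"
  by (auto simp: solutions_def)

lemma solutions_antimono: "S' \<subseteq> S \<Longrightarrow> solutions c n S \<subseteq> solutions c n S'"
  by (auto simp: solutions_def)

text \<open>The algebra is the product of its parts below \<open>y\<close> and below
  \<open>- y\<close>, and an equation can be checked on each factor; \<open>q\<close> takes the
  first factor from \<open>x\<close> and the second from \<open>p\<close>.\<close>

lemma solutions_glue:
  assumes S: "S \<subseteq> equations I n" and p: "p \<in> solutions c n S"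
    and x: "\<And>e. e \<in> S \<Longrightarrow> inf y (eval c x (fst e)) = inf y (eval c x (snd e))"
  obtains q where "q \<in> solutions c n S"
    and "\<And>t. t \<in> terms I n \<Longrightarrow> inf y (eval c q t) = inf y (eval c x t)"
    and "\<And>t. t \<in> terms I n \<Longrightarrow> inf (- y) (eval c q t) = inf (- y) (eval c p t)"
proof -
  define q where "q = (\<lambda>l\<in>{..<n}. sup (inf y (x l)) (inf (- y) (p l)))"
  have qx: "inf y (eval c q t) = inf y (eval c x t)" if "t \<in> terms I n" for t
    by (rule eval_local)
      (use that in \<open>auto simp: terms_def q_def inf_sup_distrib1 simp flip: inf_assoc\<close>)
  have qp: "inf (- y) (eval c q t) = inf (- y) (eval c p t)" if "t \<in> terms I n" for t
    by (rule eval_local)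
      (use that in \<open>auto simp: terms_def q_def inf_sup_distrib1 simp flip: inf_assoc\<close>)
  have "eval c q (fst e) = eval c q (snd e)" if e: "e \<in> S" for e
  proof (rule eq_if_inf_eq[of y])
    have t: "fst e \<in> terms I n" "snd e \<in> terms I n"
      using S e by (auto simp: in_equations_iff)
    show "inf y (eval c q (fst e)) = inf y (eval c q (snd e))"
      using x[OF e] by (simp add: qx t)
    show "inf (- y) (eval c q (fst e)) = inf (- y) (eval c q (snd e))"
      using p e by (simp add: qp t solutions_iff)
  qed
  then have "q \<in> solutions c n S"
    by (simp add: solutions_iff q_def)
  with qx qp that show thesis by blast
qed

section \<open>Compactness excludes \<open>E\<^sub>k\<close>-systems\<close>

definition shift_eq :: "nat \<Rightarrow> 'i equation \<Rightarrow> 'i equation" where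
  "shift_eq d = map_prod (map_bterm id (\<lambda>l. d + l)) (map_bterm id (\<lambda>l. d + l))"

lemma eval_shift_eq:
  "eval c v (fst (shift_eq d e)) = eval c (\<lambda>l. v (d + l)) (fst e)"
  "eval c v (snd (shift_eq d e)) = eval c (\<lambda>l. v (d + l)) (snd e)"
  by (simp_all add: shift_eq_def eval_map_bterm comp_def)

lemma shift_eq_in_equations:
  assumes "e \<in> equations I n" "d + n \<le> m"
  shows "shift_eq d e \<in> equations I m"
  using assms
  by (fastforce simp: shift_eq_def in_equations_iff terms_def bterm.set_map)

text \<open>Equality of the blocks \<open>i\<close> and \<open>j\<close> is a conjunction of
  \<open>n\<close> equations. The join of the symmetric differences packs it into one, as a covering
  consists of single equations.\<close>

definition block_eq :: "nat \<Rightarrow> nat \<Rightarrow> nat \<Rightarrow> 'i equation" where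
  "block_eq n i j = (Ors (map (\<lambda>l. symdiff (Var (i * n + l), Var (j * n + l))) [0..<n]), Zero)"

lemma eval_block_eq:
  "eval c v (fst (block_eq n i j)) = eval c v (snd (block_eq n i j))
    \<longleftrightarrow> (\<forall>l<n. v (i * n + l) = v (j * n + l))"
  using eval_Ors_le[of c v "map (\<lambda>l. symdiff (Var (i * n + l), Var (j * n + l))) [0..<n]" bot]
  by (auto simp: block_eq_def bot_unique eval_symdiff)

lemma block_index_less: "i * n + l < Suc k * n" if "i \<le> k" "l < n" for i k l n :: nat
proof -
  have "i * n + l < Suc i * n" using that by simp
  also have "\<dots> \<le> Suc k * n" using that by (intro mult_right_mono) auto
  finally show ?thesis .
qed

lemma block_eq_in_equations:
  assumes "i \<le> k" "j \<le> k"
  shows "block_eq n i j \<in> equations I (Suc k * n)"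
proof -
  have "Zero \<in> terms I (Suc k * n)"
    by (simp add: terms_def)
  moreover have "symdiff (Var (i * n + l), Var (j * n + l)) \<in> terms I (Suc k * n)"
    if "l < n" for l
    using assms that block_index_less[of _ k l n] by (simp add: terms_def symdiff_def)
  ultimately show ?thesis
    by (auto simp: block_eq_def equations_def Ors_in_terms)
qed

lemma u_omega_compact_no_E_system:
  fixes c :: "'i \<Rightarrow> 'a::boolean_algebra"
  assumes comp: "u_omega_compact I c" and E: "E_system I c k n S"
  shows False
proof -
  from E have S: "S \<subseteq> equations I n" and fin: "finite (solutions c n S)"
    and card: "card (solutions c n S) = k"
    and inf: "\<And>S'. S' \<subseteq> S \<Longrightarrow> finite S' \<Longrightarrow> infinite (solutions c n S')"
    by (auto simp: E_system_def)
  \<comment> \<open>A solution of \<open>P\<close> amounts to \<open>k + 1\<close> solutions of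
    \<open>S\<close>, the one with index \<open>i\<close> being stored in the variables
    \<open>i * n + l\<close> with \<open>l < n\<close>.\<close>
  define P where "P = (\<lambda>(i, e). shift_eq (i * n) e) ` ({..k} \<times> S)"
  define T where "T = (\<lambda>(i, j). block_eq n i j :: 'i equation) ` {(i, j). i \<le> k \<and> j \<le> k \<and> i \<noteq> j}"
  have "i * n + n \<le> Suc k * n" if "i \<le> k" for i
    using mult_right_mono[of "Suc i" "Suc k" n] that by simp
  then have P: "P \<subseteq> equations I (Suc k * n)"
    unfolding P_def using S by (auto intro!: shift_eq_in_equations)
  have T: "T \<subseteq> equations I (Suc k * n)"
    unfolding T_def by (auto simp del: mult_Suc intro!: image_subsetI block_eq_in_equations)
  have "finite T"
    unfolding T_def by (rule finite_imageI, rule finite_subset[of _ "{..k} \<times> {..k}"]) auto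
  have "solutions c (Suc k * n) P \<subseteq> (\<Union>e\<in>T. solutions c (Suc k * n) {e})"
  proof
    fix v assume v: "v \<in> solutions c (Suc k * n) P"
    define f where "f i = (\<lambda>l\<in>{..<n}. v (i * n + l))" for i
    have "f i \<in> solutions c n S" if "i \<le> k" for i
    proof -
      have "eval c (f i) (fst e) = eval c (f i) (snd e)" if e: "e \<in> S" for e
      proof -
        have f: "eval c (f i) t = eval c (\<lambda>l. v (i * n + l)) t" if "t \<in> terms I n" for t
          by (rule eval_cong) (use that in \<open>auto simp: f_def terms_def\<close>)
        have "shift_eq (i * n) e \<in> P"
          using \<open>i \<le> k\<close> e by (force simp: P_def)
        with v have "eval c v (fst (shift_eq (i * n) e)) = eval c v (snd (shift_eq (i * n) e))"
          by (simp add: solutions_iff)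
        moreover have "fst e \<in> terms I n" "snd e \<in> terms I n"
          using S e by (auto simp: in_equations_iff)
        ultimately show ?thesis
          by (simp add: eval_shift_eq f)
      qed
      then show ?thesis
        by (simp add: solutions_iff f_def)
    qed
    then have "f ` {..k} \<subseteq> solutions c n S" by auto
    then have "card (f ` {..k}) \<le> k"
      using card_mono[OF fin] card by metis
    then have "\<not> inj_on f {..k}"
      using card_image[of f "{..k}"] by auto
    then obtain i j where ij: "i \<le> k" "j \<le> k" "i \<noteq> j" "f i = f j"
      by (auto simp: inj_on_def)
    have "v (i * n + l) = v (j * n + l)" if "l < n" for l
      using fun_cong[OF ij(4), of l] that by (simp add: f_def)
    then have "v \<in> solutions c (Suc k * n) {block_eq n i j}"
      using v by (simp add: solutions_iff eval_block_eq)
    moreover have "block_eq n i j \<in> T"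
      using ij by (auto simp: T_def)
    ultimately show "v \<in> (\<Union>e\<in>T. solutions c (Suc k * n) {e})"
      by blast
  qed
  with comp P T \<open>finite T\<close> obtain P' where P': "P' \<subseteq> P" "finite P'"
    and cover: "solutions c (Suc k * n) P' \<subseteq> (\<Union>e\<in>T. solutions c (Suc k * n) {e})"
    unfolding u_omega_compact_def by metis
  obtain Q where Q: "Q \<subseteq> {..k} \<times> S" "finite Q" "P' = (\<lambda>(i, e). shift_eq (i * n) e) ` Q"
    using finite_subset_image[OF P'(2) P'(1)[unfolded P_def]] by blast
  \<comment> \<open>The equations of \<open>S\<close> that have a copy chosen in \<open>Q\<close>
    form a finite subsystem. Any \<open>k + 1\<close> distinct solutions of it, laid out as blocks,
    solve \<open>P'\<close> without satisfying any equation of \<open>T\<close>.\<close>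
  have "infinite (solutions c n (snd ` Q))"
    by (rule inf) (use Q in auto)
  then obtain X where X: "X \<subseteq> solutions c n (snd ` Q)" "finite X" "card X = Suc k"
    using infinite_arbitrarily_large by blast
  then obtain f where f: "bij_betw f {..k} X"
    using finite_same_card_bij[of "{..k}" X] by auto
  define v where "v = (\<lambda>l\<in>{..<Suc k * n}. f (l div n) (l mod n))"
  have v: "v (i * n + l) = f i l" if "i \<le> k" "l < n" for i l
    using block_index_less[OF that] that by (simp add: v_def)
  have "v \<in> solutions c (Suc k * n) P'"
  proof -
    have "eval c v (fst (shift_eq (i * n) e)) = eval c v (snd (shift_eq (i * n) e))"
      if ie: "(i, e) \<in> Q" for i e
    proof -
      have i: "i \<le> k" and e: "e \<in> S" using ie Q by auto
      have "eval c (\<lambda>l. v (i * n + l)) t = eval c (f i) t" if "t \<in> terms I n" for t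
        by (rule eval_cong) (use that v[OF i] in \<open>auto simp: terms_def\<close>)
      moreover have "fst e \<in> terms I n" "snd e \<in> terms I n"
        using S e by (auto simp: in_equations_iff)
      moreover have "f i \<in> solutions c n (snd ` Q)"
        using bij_betwE[OF f] i X(1) by auto
      then have "eval c (f i) (fst e) = eval c (f i) (snd e)"
        using ie by (force simp: solutions_iff)
      ultimately show ?thesis
        by (simp add: eval_shift_eq)
    qed
    then show ?thesis
      by (auto simp: solutions_iff Q(3) v_def)
  qed
  with cover obtain i j where ij: "i \<le> k" "j \<le> k" "i \<noteq> j"
    and "v \<in> solutions c (Suc k * n) {block_eq n i j}"
    by (auto simp: T_def)
  then have eq: "f i l = f j l" if "l < n" for l
    using that v by (simp add: solutions_iff eval_block_eq)
  have "f i \<in> {..<n} \<rightarrow>\<^sub>E UNIV" "f j \<in> {..<n} \<rightarrow>\<^sub>E UNIV"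
    using bij_betwE[OF f] ij X(1) by (auto simp: solutions_iff subset_iff)
  then have "f i = f j"
    by (rule PiE_ext) (simp add: eq)
  then show False
    using bij_betw_imp_inj_on[OF f] ij by (auto simp: inj_on_def)
qed

section \<open>Compactness from the absence of \<open>E\<^sub>k\<close>-systems\<close>

text \<open>Taking \<open>k\<close> to be the number of solutions of \<open>S\<close> yields a
  finite subsystem with finitely many solutions. Each surplus solution is then removed by one
  further equation of \<open>S\<close>.\<close>

lemma finite_subsystem_same_solutions:
  assumes noE: "\<And>k. \<not> E_system I c k n S"
    and S: "S \<subseteq> equations I n" and fin: "finite (solutions c n S)"
  obtains S' where "S' \<subseteq> S" "finite S'" "solutions c n S' = solutions c n S"
proof -
  obtain S1 where S1: "S1 \<subseteq> S" "finite S1" "finite (solutions c n S1)"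
    using noE[of "card (solutions c n S)"] S fin by (auto simp: E_system_def)
  have "\<exists>e\<in>S. v \<notin> solutions c n {e}" if "v \<in> solutions c n S1 - solutions c n S" for v
    using that by (auto simp: solutions_iff)
  then obtain g where g: "\<And>v. v \<in> solutions c n S1 - solutions c n S \<Longrightarrow>
      g v \<in> S \<and> v \<notin> solutions c n {g v}"
    by metis
  define S' where "S' = S1 \<union> g ` (solutions c n S1 - solutions c n S)"
  have sub: "S' \<subseteq> S" and "finite S'"
    using S1 g by (auto simp: S'_def)
  moreover have "v \<in> solutions c n S" if v: "v \<in> solutions c n S'" for v
  proof (rule ccontr)
    assume "v \<notin> solutions c n S"
    moreover have "v \<in> solutions c n S1"
      using v solutions_antimono[of S1 S' c n] by (auto simp: S'_def)
    ultimately have "v \<notin> solutions c n {g v}" "g v \<in> S'"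
      using g[of v] by (auto simp: S'_def)
    with v show False
      using solutions_antimono[of "{g v}" S' c n] by auto
  qed
  then have "solutions c n S' = solutions c n S"
    using solutions_antimono[OF sub, of c n] by auto
  ultimately show thesis
    by (rule that)
qed

text \<open>
  The additional variable \<open>n\<close> is \<open>y\<close>: the system \<open>S\<close> holds below \<open>y\<close>, \<open>y \<le> \<sigma>(x)\<close> and \<open>x \<le> y\<close>.
\<close>

definition localize :: "nat \<Rightarrow> ('i, nat) bterm \<Rightarrow> 'i equation set \<Rightarrow> 'i equation set" where
  "localize n \<sigma> S = (\<lambda>e. (And (Var n) (symdiff e), Zero)) ` S \<union>
    ({(And (Var n) (Neg \<sigma>), Zero)} \<union> (\<lambda>l. (And (Var l) (Neg (Var n)), Zero)) ` {..<n})"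

lemma localize_in_equations:
  fixes S :: "'i equation set"
  assumes "S \<subseteq> equations I n" "\<sigma> \<in> terms I n"
  shows "localize n \<sigma> S \<subseteq> equations I (Suc n)"
proof -
  have suc: "t \<in> terms I (Suc n)" if "t \<in> terms I n" for t :: "('i, nat) bterm"
    using that by (auto simp: terms_def less_Suc_eq)
  have con: "(And s t, Zero) \<in> equations I (Suc n)"
    if "s \<in> terms I (Suc n)" "t \<in> terms I (Suc n)" for s t :: "('i, nat) bterm"
    using that by (auto simp: in_equations_iff terms_def)
  have neg: "Neg t \<in> terms I (Suc n)" if "t \<in> terms I (Suc n)" for t :: "('i, nat) bterm"
    using that by (simp add: terms_def)
  have "Var l \<in> terms I (Suc n)" if "l \<le> n" for l
    using that by (simp add: terms_def)
  moreover have "symdiff e \<in> terms I (Suc n)" if "e \<in> S" for e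
    using subsetD[OF assms(1) that] by (simp add: symdiff_in_terms in_equations_iff suc)
  moreover have "\<sigma> \<in> terms I (Suc n)"
    using assms(2) suc by blast
  ultimately show ?thesis
    by (auto simp: localize_def intro!: con neg)
qed

lemma solutions_localize:
  "v \<in> solutions c (Suc n) (localize n \<sigma> S) \<longleftrightarrow>
    v \<in> {..<Suc n} \<rightarrow>\<^sub>E UNIV \<and>
    (\<forall>e\<in>S. inf (v n) (eval c v (fst e)) = inf (v n) (eval c v (snd e))) \<and>
    v n \<le> eval c v \<sigma> \<and> (\<forall>l<n. v l \<le> v n)"
  by (auto simp: solutions_iff localize_def inf_eval_symdiff inf_compl_eq_bot_iff ball_Un)

text \<open>Only the equations coming from \<open>S\<close> can be infinite in number; the bounds on
  the variables are finitely many and belong to every \<open>localize n \<sigma> S'\<close>.\<close>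

lemma finite_subset_localize:
  assumes "R \<subseteq> localize n \<sigma> S" "finite R"
  obtains S' where "S' \<subseteq> S" "finite S'" "R \<subseteq> localize n \<sigma> S'"
proof -
  let ?f = "\<lambda>e. (And (Var n) (symdiff e), Zero)"
  obtain S' where S': "S' \<subseteq> S" "finite S'" "R \<inter> ?f ` S = ?f ` S'"
    using finite_subset_image[of "R \<inter> ?f ` S" ?f S] assms(2) by auto
  have "R \<subseteq> localize n \<sigma> S'"
    using assms(1) unfolding localize_def S'(3)[symmetric] by blast
  with S'(1,2) show thesis
    by (rule that)
qed

lemma no_E_system_cover:
  fixes c :: "'i \<Rightarrow> 'a::boolean_algebra"
  assumes noE: "\<And>k n S. \<not> E_system I c k n S"
    and S: "S \<subseteq> equations I n" and A: "A \<subseteq> equations I n" "finite A"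
    and cover: "solutions c n S \<subseteq> (\<Union>e\<in>A. solutions c n {e})"
    and min: "\<And>A'. A' \<subset> A \<Longrightarrow> \<not> solutions c n S \<subseteq> (\<Union>e\<in>A'. solutions c n {e})"
    and p0: "p0 \<in> solutions c n S"
  shows "\<exists>S'\<subseteq>S. finite S' \<and> solutions c n S' \<subseteq> (\<Union>e\<in>A. solutions c n {e})"
proof -
  have sol: "v \<in> solutions c n {e} \<longleftrightarrow> v \<in> {..<n} \<rightarrow>\<^sub>E UNIV \<and> eval c v (symdiff e) = bot" for v e
    by (simp add: solutions_iff eval_symdiff)
  have ext: "v \<in> {..<n} \<rightarrow>\<^sub>E UNIV" if "v \<in> solutions c n S'" for v S'
    using that by (simp add: solutions_iff)
  have sd: "symdiff e \<in> terms I n" if "e \<in> A" for e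
    using A that by (auto simp: symdiff_in_terms)
  obtain es where es: "set es = A"
    using \<open>finite A\<close> finite_list by blast
  define \<sigma> where "\<sigma> = Ors (map symdiff es)"
  have \<sigma>: "\<sigma> \<in> terms I n"
    by (auto simp: \<sigma>_def Ors_in_terms es sd)
  have \<sigma>_le: "eval c v \<sigma> \<le> u \<longleftrightarrow> (\<forall>e\<in>A. eval c v (symdiff e) \<le> u)" for v u
    by (simp add: \<sigma>_def eval_Ors_le es)
  have "\<exists>p\<in>solutions c n S. \<forall>e'\<in>A - {e}. eval c p (symdiff e') \<noteq> bot" if "e \<in> A" for e
  proof -
    have "A - {e} \<subset> A" using that by blast
    from min[OF this] show ?thesis
      using ext by (fastforce simp: sol)
  qed
  then obtain p where p: "\<And>e. e \<in> A \<Longrightarrow> p e \<in> solutions c n S"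
    "\<And>e e'. e \<in> A \<Longrightarrow> e' \<in> A \<Longrightarrow> e' \<noteq> e \<Longrightarrow> eval c (p e) (symdiff e') \<noteq> bot"
    by (metis DiffI singletonD)
  define J where "J = {u. \<exists>q\<in>solutions c n S. u \<le> eval c q \<sigma>}"
  define F where "F = (\<lambda>(e, e'). eval c (p e) (symdiff e')) ` (SIGMA e:A. A - {e})"
  have "finite J"
  proof (rule finite_down_set_if_dominating[where F = F])
    show "v \<in> J" if "u \<in> J" "v \<le> u" for u v
      using that by (auto simp: J_def intro: order_trans)
    show "finite F"
      using \<open>finite A\<close> by (simp add: F_def)
    show "bot \<notin> F"
      using p(2) by (fastforce simp: F_def)
    show "\<exists>a\<in>F. a \<le> u" if "u \<in> J" "u \<noteq> bot" for u
    proof (rule ccontr)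
      assume none: "\<not> (\<exists>a\<in>F. a \<le> u)"
      obtain q where q: "q \<in> solutions c n S" "u \<le> eval c q \<sigma>"
        using \<open>u \<in> J\<close> by (auto simp: J_def)
      \<comment> \<open>Since \<open>u\<close> lies below the join of these values at
        \<open>q\<close>, being disjoint from all of them would make it zero.\<close>
      have "\<exists>e\<in>A. inf u (eval c q (symdiff e)) \<noteq> bot"
      proof (rule ccontr)
        assume "\<not> ?thesis"
        then have "eval c q \<sigma> \<le> - u"
          by (metis \<sigma>_le double_compl inf.commute inf_compl_eq_bot_iff)
        with q(2) have "u \<le> - u" by (rule order_trans)
        then show False
          using \<open>u \<noteq> bot\<close> by (metis inf.absorb1 inf_compl_bot)
      qed
      then obtain e where e: "e \<in> A" "inf u (eval c q (symdiff e)) \<noteq> bot" ..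
      have "inf u (eval c q (fst e')) = inf u (eval c q (snd e'))" if "e' \<in> S" for e'
        using q(1) that by (simp add: solutions_iff)
      \<comment> \<open>With \<open>q\<close> below \<open>u\<close> and \<open>p e\<close> outside
        it, \<open>r\<close> violates every equation of \<open>A\<close>: \<open>e\<close> fails
        below \<open>u\<close>, and any other \<open>e'\<close> fails outside \<open>u\<close>,
        since its value at \<open>p e\<close> is in \<open>F\<close> and hence not below
        \<open>u\<close>.\<close>
      then obtain r where r: "r \<in> solutions c n S"
        "\<And>t. t \<in> terms I n \<Longrightarrow> inf u (eval c r t) = inf u (eval c q t)"
        "\<And>t. t \<in> terms I n \<Longrightarrow> inf (- u) (eval c r t) = inf (- u) (eval c (p e) t)"
        using solutions_glue[OF S p(1)[OF e(1)], of u q] by metis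
      have "eval c r (symdiff e') \<noteq> bot" if e': "e' \<in> A" for e'
      proof (cases "e' = e")
        case True
        with e r(2)[OF sd[OF e']] show ?thesis by auto
      next
        case False
        then have "eval c (p e) (symdiff e') \<in> F"
          using e(1) e' by (force simp: F_def)
        with none have "\<not> eval c (p e) (symdiff e') \<le> u" by blast
        then have "inf (- u) (eval c (p e) (symdiff e')) \<noteq> bot"
          by (metis inf.commute inf_compl_eq_bot_iff)
        with r(3)[OF sd[OF e']] show ?thesis by auto
      qed
      with cover r(1) show False
        by (auto simp: sol)
    qed
  qed
  define R where "R = localize n \<sigma> S"
  have glue: "\<exists>q\<in>solutions c n S. \<forall>t\<in>terms I n. inf (v n) (eval c q t) = inf (v n) (eval c v t)"
    if "v \<in> solutions c (Suc n) R" for v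
  proof -
    have "inf (v n) (eval c v (fst e)) = inf (v n) (eval c v (snd e))" if "e \<in> S" for e
      using \<open>v \<in> solutions c (Suc n) R\<close> that by (auto simp: R_def solutions_localize)
    then show ?thesis
      using solutions_glue[OF S p0, of "v n" v] by metis
  qed
  \<comment> \<open>The coordinate \<open>v n\<close> is below the value of \<open>\<sigma>\<close>
    at a solution of \<open>S\<close> obtained by gluing, and it bounds all other coordinates; hence
    all of them lie in the finite set \<open>J\<close>.\<close>
  have "solutions c (Suc n) R \<subseteq> {..<Suc n} \<rightarrow>\<^sub>E J"
  proof
    fix v assume v: "v \<in> solutions c (Suc n) R"
    then have v': "v \<in> {..<Suc n} \<rightarrow>\<^sub>E UNIV" "v n \<le> eval c v \<sigma>" "\<And>l. l < n \<Longrightarrow> v l \<le> v n"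
      by (auto simp: R_def solutions_localize)
    obtain q where q: "q \<in> solutions c n S" "inf (v n) (eval c q \<sigma>) = inf (v n) (eval c v \<sigma>)"
      using glue[OF v] \<sigma> by blast
    have "v n \<le> eval c q \<sigma>"
      using v'(2) q(2) by (metis inf.absorb1 inf.cobounded2)
    then have "v l \<in> J" if "l < Suc n" for l
      using that q(1) v'(3)[of l] unfolding J_def less_Suc_eq by (blast intro: order_trans)
    with v'(1) show "v \<in> {..<Suc n} \<rightarrow>\<^sub>E J"
      by (auto simp: PiE_iff)
  qed
  then have "finite (solutions c (Suc n) R)"
    by (rule finite_subset) (simp add: finite_PiE \<open>finite J\<close>)
  moreover have "R \<subseteq> equations I (Suc n)"
    using localize_in_equations[OF S \<sigma>] by (simp add: R_def)
  ultimately obtain R' where R': "R' \<subseteq> R" "finite R'"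
    "solutions c (Suc n) R' = solutions c (Suc n) R"
    using finite_subsystem_same_solutions[of I c "Suc n" R] noE by metis
  obtain S' where S': "S' \<subseteq> S" "finite S'" "R' \<subseteq> localize n \<sigma> S'"
    using finite_subset_localize R'(1,2) unfolding R_def by metis
  have "x \<in> (\<Union>e\<in>A. solutions c n {e})" if x: "x \<in> solutions c n S'" for x
  proof -
    define y where "y = eval c x \<sigma>"
    \<comment> \<open>Cutting \<open>x\<close> down to \<open>y\<close> enforces the bound
      \<open>v l \<le> y\<close> and preserves, below \<open>y\<close>, the values of all terms in
      the first \<open>n\<close> variables.\<close>
    define v where "v = (\<lambda>l\<in>{..<Suc n}. if l = n then y else inf y (x l))"
    have vn: "v n = y" by (simp add: v_def)
    have vx: "inf y (eval c v t) = inf y (eval c x t)" if "t \<in> terms I n" for t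
      by (rule eval_local)
        (use that in \<open>auto simp: terms_def v_def subset_iff less_Suc_eq simp flip: inf_assoc\<close>)
    have "v \<in> solutions c (Suc n) (localize n \<sigma> S')"
      unfolding solutions_localize vn
    proof (intro conjI ballI allI impI)
      show "v \<in> {..<Suc n} \<rightarrow>\<^sub>E UNIV" by (simp add: v_def)
      show "inf y (eval c v (fst e)) = inf y (eval c v (snd e))" if "e \<in> S'" for e
      proof -
        have "fst e \<in> terms I n" "snd e \<in> terms I n"
          using S S'(1) that by (auto simp: in_equations_iff)
        then show ?thesis
          using x that by (simp add: vx solutions_iff)
      qed
      show "y \<le> eval c v \<sigma>"
        using vx[OF \<sigma>] by (simp add: y_def inf.absorb_iff1)
      show "v l \<le> y" if "l < n" for l
        using that by (simp add: v_def)
    qed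
    then have "v \<in> solutions c (Suc n) R"
      using R'(3) solutions_antimono[OF S'(3)] by blast
    from glue[OF this] obtain q where q: "q \<in> solutions c n S"
      "\<And>t. t \<in> terms I n \<Longrightarrow> inf y (eval c q t) = inf y (eval c x t)"
      by (metis vn vx)
    \<comment> \<open>The value of \<open>symdiff e\<close> at \<open>x\<close> is disjoint from
      \<open>y\<close>, because \<open>x\<close> and \<open>q\<close> agree below \<open>y\<close>,
      and it is below \<open>y\<close>, because \<open>y\<close> is the join of such values at
      \<open>x\<close>. So it vanishes.\<close>
    obtain e where e: "e \<in> A" "eval c q (symdiff e) = bot"
      using cover q(1) by (auto simp: sol)
    have "eval c x (symdiff e) \<le> y"
      using \<sigma>_le[of x y] e(1) by (simp add: y_def)
    moreover have "inf y (eval c x (symdiff e)) = bot"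
      using q(2)[OF sd[OF e(1)]] e(2) by simp
    ultimately have "eval c x (symdiff e) = bot"
      by (simp add: inf.absorb2)
    then show ?thesis
      using e(1) ext[OF x] by (auto simp: sol)
  qed
  with S' show ?thesis by blast
qed

theorem theorem6p4:
  fixes I :: "'i set" and c :: "'i \<Rightarrow> 'a::boolean_algebra"
  shows "u_omega_compact I c \<longleftrightarrow> (\<forall>k::nat. \<not> (\<exists>n S. E_system I c k n S))"
proof
  assume "u_omega_compact I c"
  then show "\<forall>k. \<not> (\<exists>n S. E_system I c k n S)"
    using u_omega_compact_no_E_system by blast
next
  assume "\<forall>k. \<not> (\<exists>n S. E_system I c k n S)"
  then have noE: "\<not> E_system I c k n S" for k n S by blast
  show "u_omega_compact I c"
    unfolding u_omega_compact_def
  proof (intro allI impI)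
    fix n S T
    assume S: "S \<subseteq> equations I n" and T: "T \<subseteq> equations I n" "finite T"
      and cover: "solutions c n S \<subseteq> (\<Union>e\<in>T. solutions c n {e})"
    show "\<exists>S'\<subseteq>S. finite S' \<and> solutions c n S' \<subseteq> (\<Union>e\<in>T. solutions c n {e})"
    proof (cases "solutions c n S = {}")
      \<comment> \<open>Here there is no solution to glue onto, but an empty solution set is finite,
        and excluding \<open>k = 0\<close> settles the case.\<close>
      case True
      then obtain S' where "S' \<subseteq> S" "finite S'" "solutions c n S' = {}"
        using finite_subsystem_same_solutions[OF noE S] by auto
      then show ?thesis by auto
    next
      case False
      then obtain p0 where p0: "p0 \<in> solutions c n S" by blast
      define M where "M = {A \<in> Pow T. solutions c n S \<subseteq> (\<Union>e\<in>A. solutions c n {e})}"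
      have "finite M" "M \<noteq> {}"
        using T(2) cover by (auto simp: M_def)
      then obtain A where A: "A \<in> M" and min: "\<And>A'. A' \<in> M \<Longrightarrow> A' \<subseteq> A \<Longrightarrow> A = A'"
        using finite_has_minimal[of M] by blast
      have AT: "A \<subseteq> T" and covA: "solutions c n S \<subseteq> (\<Union>e\<in>A. solutions c n {e})"
        using A by (auto simp: M_def)
      have "\<not> solutions c n S \<subseteq> (\<Union>e\<in>A'. solutions c n {e})" if "A' \<subset> A" for A'
        using min[of A'] that AT by (auto simp: M_def)
      then obtain S' where S': "S' \<subseteq> S" "finite S'"
        "solutions c n S' \<subseteq> (\<Union>e\<in>A. solutions c n {e})"
        using no_E_system_cover[OF noE S order_trans[OF AT T(1)] finite_subset[OF AT T(2)] covA _ p0]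
        by metis
      have "(\<Union>e\<in>A. solutions c n {e}) \<subseteq> (\<Union>e\<in>T. solutions c n {e})"
        using AT by (rule UN_mono) simp
      with S'(3) have "solutions c n S' \<subseteq> (\<Union>e\<in>T. solutions c n {e})"
        by (rule order_trans)
      with S'(1,2) show ?thesis
        by (intro exI conjI)
    qed
  qed
qed

end
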